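(* Let $(N,A,c)$ be an axes-cutting public bads instance. For each $i\in N$ let $\alpha_i=c_i(a_i)$, where $a_i\in A$ is the alternative that only imposes costs on $i$, and let $\delta=\min\{c_i(a): i\in N,\ a\in A,\ c_i(a)>0\}$ be the smallest positive cost in the instance. Then, for every $0<\epsilon\le1$, the Greedy Frank–Wolfe algorithm finds an $\epsilon$-approximate zero-respecting Lindahl equilibrium in $O\!\left(\frac{\sum_{i\in N}\log(\alpha_i/\delta)}{\epsilon^2}\right)$ iterations.
   Context: A public bads instance $(N,A,c)$ consists of agents $N=\{1,\dots,n\}$, a finite set $A$ of alternatives (bads), and cost functions $c_i:A\to\mathbb{R}_{\ge 0}$, $i\in N$. $\Delta(A)$ is the set of lotteries (probability vectors) on $A$; $c_i(y)=\sum_{a\in A}y(a)c_i(a)$ for $y\in\mathbb{R}^A_{\ge0}$ and $c(y)=(c_i(y))_{i\in N}$. Standing assumptions: $0\notin\{c(x):x\in\Delta(A)\}$, and for every $i\in N$ there is $a\in A$ with $c_i(a)<\max_{a'\in A}c_i(a')$. The instance is axes-cutting if for every $i\in N$ there is $a_i\in A$ with $c_i(a_i)>0$ and $c_{i'}(a_i)=0$ for all $i'\in N\setminus\{i\}$. $\epsilon$-approximate zero-respecting Lindahl equilibrium: a pair $(x,p)$ with $x\in\Delta(A)$ and $p=(p_i:A\to\mathbb{R}_{\ge0})_{i\in N}$ such that (1) for every $i\in N$ and $a\in A$, $p_i(a)=0$ whenever $c_i(a)=0$; (2) $\frac1n-\epsilon\le p_i\cdot x\le\frac1n+\epsilon$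 for all $i\in N$; (3) for every $i\in N$ and $y\in\mathbb{R}^A_{\ge0}$ with $p_i\cdot y\ge p_i\cdot x$ we have $c_i(y)\ge c_i(x)$; (4) $\sum_{i\in N}p_i(a)\ge1$ for every $a\in A$, with equality if $x(a)>0$. Here $p_i\cdot y=\sum_{a\in A}p_i(a)y(a)$. Greedy Frank–Wolfe algorithm (applied to the program: maximize $-\sum_{i\in N}\frac1n\log\beta_i$ over $\mathcal{X}=\{\beta\ge0:\sum_{i\in N}c_i(a)\beta_i\ge1\ \forall a\in A\}$): start at $\beta^0$ with $\beta^0_i=1/\delta$ for all $i$ and use stopping tolerance $\eta=\epsilon/4$. In iteration $t=1,2,\dots$ let $\beta^t$ be an optimal solution of the linear program $\min_{\beta\in\mathcal{X}}\sum_{i\in N}\frac1n\frac{\beta_i}{\beta_i^{t-1}}$; stop as soon as $\sum_{i\in N}\bigl(\frac{\beta^t_i}{\beta^{t-1}_i}-1\bigr)^2\le\eta^2$. On stopping, let $x^t$ be an optimal solution of the dual linear program $\max\{\sum_{a\in A}x_a: x\ge0,\ \sum_{a\in A}c_i(a)x_a\le\frac{1}{n\beta_i^{t-1}}\ \forall i\in N\}$; the pair found is $(\bar x,p)$ with $\bar x=x^t/\sum_{a\in A}x^t_a$ and $p_i(a)=c_i(a)\beta_i^t$.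
   Formalization: The iteration bound is proved as 1 + C·Σ log(α_i/δ)/ε² with an absolute constant C; the additive 1 is needed because at least one iteration is always performed, while the sum is 0 when all α_i = δ. *)

theory Defs
  imports Complex_Main
begin

text \<open>
  The agents are \<open>{1..n}\<close>. A vector indexed by agents (by alternatives) is a function of type
  \<open>nat \<Rightarrow> real\<close> (of type \<open>'a \<Rightarrow> real\<close>) whose values outside \<open>{1..n}\<close> (outside \<open>A\<close>) are
  irrelevant: all notions below look only at arguments in \<open>{1..n}\<close> and \<open>A\<close>. The number of agents and
  the set of alternatives are explicit, rather than index types, so that the constant
  hidden in an O-bound can be chosen independently of them.
\<close>

definition nonneg_vectors :: "'a set \<Rightarrow> ('a \<Rightarrow> real) set" where
  "nonneg_vectors A = {y. \<forall>a\<in>A. 0 \<le> y a}"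

definition lotteries :: "'a set \<Rightarrow> ('a \<Rightarrow> real) set" where
  "lotteries A = {x \<in> nonneg_vectors A. (\<Sum>a\<in>A. x a) = 1}"

text \<open>\<open>pair A (c i) y\<close> is $c_i(y)$, and \<open>pair A (p i) y\<close> is $p_i \cdot y$.\<close>

definition pair :: "'a set \<Rightarrow> ('a \<Rightarrow> real) \<Rightarrow> ('a \<Rightarrow> real) \<Rightarrow> real" where
  "pair A f y = (\<Sum>a\<in>A. f a * y a)"

definition public_bads :: "nat \<Rightarrow> 'a set \<Rightarrow> (nat \<Rightarrow> 'a \<Rightarrow> real) \<Rightarrow> bool" where
  "public_bads n A c \<longleftrightarrow>
     1 \<le> n \<and> finite A \<and>
     (\<forall>i\<in>{1..n}. \<forall>a\<in>A. 0 \<le> c i a) \<and>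
     \<not> (\<exists>x\<in>lotteries A. \<forall>i\<in>{1..n}. pair A (c i) x = 0) \<and>
     (\<forall>i\<in>{1..n}. \<exists>a\<in>A. c i a < Max (c i ` A))"

definition cuts_axis :: "nat \<Rightarrow> 'a set \<Rightarrow> (nat \<Rightarrow> 'a \<Rightarrow> real) \<Rightarrow> nat \<Rightarrow> 'a \<Rightarrow> bool" where
  "cuts_axis n A c i a \<longleftrightarrow> a \<in> A \<and> 0 < c i a \<and> (\<forall>i'\<in>{1..n} - {i}. c i' a = 0)"

definition axes_cutting :: "nat \<Rightarrow> 'a set \<Rightarrow> (nat \<Rightarrow> 'a \<Rightarrow> real) \<Rightarrow> bool" where
  "axes_cutting n A c \<longleftrightarrow> (\<forall>i\<in>{1..n}. \<exists>a. cuts_axis n A c i a)"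

definition min_pos_cost :: "nat \<Rightarrow> 'a set \<Rightarrow> (nat \<Rightarrow> 'a \<Rightarrow> real) \<Rightarrow> real" where
  "min_pos_cost n A c = Min {c i a | i a. i \<in> {1..n} \<and> a \<in> A \<and> 0 < c i a}"

definition approx_zero_respecting_LE ::
  "nat \<Rightarrow> 'a set \<Rightarrow> (nat \<Rightarrow> 'a \<Rightarrow> real) \<Rightarrow> real \<Rightarrow> ('a \<Rightarrow> real) \<Rightarrow> (nat \<Rightarrow> 'a \<Rightarrow> real) \<Rightarrow> bool" where
  "approx_zero_respecting_LE n A c \<epsilon> x p \<longleftrightarrow>
     x \<in> lotteries A \<and>
     (\<forall>i\<in>{1..n}. p i \<in> nonneg_vectors A) \<and>
     (\<forall>i\<in>{1..n}. \<forall>a\<in>A. c i a = 0 \<longrightarrow> p i a = 0) \<and>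
     (\<forall>i\<in>{1..n}. 1 / real n - \<epsilon> \<le> pair A (p i) x \<and> pair A (p i) x \<le> 1 / real n + \<epsilon>) \<and>
     (\<forall>i\<in>{1..n}. \<forall>y\<in>nonneg_vectors A.
        pair A (p i) x \<le> pair A (p i) y \<longrightarrow> pair A (c i) x \<le> pair A (c i) y) \<and>
     (\<forall>a\<in>A. 1 \<le> (\<Sum>i=1..n. p i a) \<and> (0 < x a \<longrightarrow> (\<Sum>i=1..n. p i a) = 1))"

definition feasible :: "nat \<Rightarrow> 'a set \<Rightarrow> (nat \<Rightarrow> 'a \<Rightarrow> real) \<Rightarrow> (nat \<Rightarrow> real) set" where
  "feasible n A c = {\<beta>. (\<forall>i\<in>{1..n}. 0 \<le> \<beta> i) \<and> (\<forall>a\<in>A. 1 \<le> (\<Sum>i=1..n. c i a * \<beta> i))}"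

definition primal_optimal ::
  "nat \<Rightarrow> 'a set \<Rightarrow> (nat \<Rightarrow> 'a \<Rightarrow> real) \<Rightarrow> (nat \<Rightarrow> real) \<Rightarrow> (nat \<Rightarrow> real) \<Rightarrow> bool" where
  "primal_optimal n A c b b' \<longleftrightarrow>
     is_arg_min (\<lambda>\<beta>. \<Sum>i=1..n. 1 / real n * (\<beta> i / b i)) (\<lambda>\<beta>. \<beta> \<in> feasible n A c) b'"

definition dual_optimal ::
  "nat \<Rightarrow> 'a set \<Rightarrow> (nat \<Rightarrow> 'a \<Rightarrow> real) \<Rightarrow> (nat \<Rightarrow> real) \<Rightarrow> ('a \<Rightarrow> real) \<Rightarrow> bool" where
  "dual_optimal n A c b x \<longleftrightarrow>
     is_arg_max (\<lambda>y. \<Sum>a\<in>A. y a)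
       (\<lambda>y. y \<in> nonneg_vectors A \<and> (\<forall>i\<in>{1..n}. pair A (c i) y \<le> 1 / (real n * b i))) x"

definition fw_stop :: "nat \<Rightarrow> real \<Rightarrow> (nat \<Rightarrow> real) \<Rightarrow> (nat \<Rightarrow> real) \<Rightarrow> bool" where
  "fw_stop n \<eta> b b' \<longleftrightarrow> (\<Sum>i=1..n. (b' i / b i - 1)\<^sup>2) \<le> \<eta>\<^sup>2"

text \<open>
  The linear programs may have several optimal solutions, so the algorithm is nondeterministic.
  \<open>fw_execution n A c \<epsilon> \<beta> T\<close> says that \<open>\<beta> 0, \<dots>, \<beta> T\<close> are the iterates of a possible (not
  necessarily complete) execution with tolerance \<open>\<epsilon> / 4\<close> that has performed \<open>T\<close> iterations, none of
  which, except possibly the last one, met the stopping criterion. It is complete if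
  \<open>fw_stopped n \<epsilon> \<beta> T\<close>.
\<close>

definition fw_stopped :: "nat \<Rightarrow> real \<Rightarrow> (nat \<Rightarrow> nat \<Rightarrow> real) \<Rightarrow> nat \<Rightarrow> bool" where
  "fw_stopped n \<epsilon> \<beta> t \<longleftrightarrow> 1 \<le> t \<and> fw_stop n (\<epsilon> / 4) (\<beta> (t - 1)) (\<beta> t)"

definition fw_execution ::
  "nat \<Rightarrow> 'a set \<Rightarrow> (nat \<Rightarrow> 'a \<Rightarrow> real) \<Rightarrow> real \<Rightarrow> (nat \<Rightarrow> nat \<Rightarrow> real) \<Rightarrow> nat \<Rightarrow> bool" where
  "fw_execution n A c \<epsilon> \<beta> T \<longleftrightarrow>
     (\<forall>i\<in>{1..n}. \<beta> 0 i = 1 / min_pos_cost n A c) \<and>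
     (\<forall>t\<in>{1..T}. primal_optimal n A c (\<beta> (t - 1)) (\<beta> t)) \<and>
     (\<forall>t<T. \<not> fw_stopped n \<epsilon> \<beta> t)"

definition fw_lottery :: "'a set \<Rightarrow> ('a \<Rightarrow> real) \<Rightarrow> 'a \<Rightarrow> real" where
  "fw_lottery A x a = x a / (\<Sum>a'\<in>A. x a')"

definition fw_prices :: "(nat \<Rightarrow> 'a \<Rightarrow> real) \<Rightarrow> (nat \<Rightarrow> real) \<Rightarrow> nat \<Rightarrow> 'a \<Rightarrow> real" where
  "fw_prices c b i a = c i a * b i"

text \<open>
  The algorithm, whatever optimal solutions it picks, never gets stuck, stops after at most \<open>K\<close>
  iterations, and then the pair it finds is an approximate equilibrium: an execution that has not
  stopped can be continued, no execution is longer than \<open>K\<close>, and the output of a stopped one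
  exists and is correct.
\<close>

definition greedy_fw_finds_LE_within ::
  "nat \<Rightarrow> 'a set \<Rightarrow> (nat \<Rightarrow> 'a \<Rightarrow> real) \<Rightarrow> real \<Rightarrow> real \<Rightarrow> bool" where
  "greedy_fw_finds_LE_within n A c \<epsilon> K \<longleftrightarrow>
     (\<forall>\<beta> T. fw_execution n A c \<epsilon> \<beta> T \<longrightarrow>
        real T \<le> K \<and>
        (\<not> fw_stopped n \<epsilon> \<beta> T \<longrightarrow> (\<exists>b. primal_optimal n A c (\<beta> T) b)) \<and>
        (fw_stopped n \<epsilon> \<beta> T \<longrightarrow>
           (\<exists>x. dual_optimal n A c (\<beta> (T - 1)) x) \<and>
           (\<forall>x. dual_optimal n A c (\<beta> (T - 1)) x \<longrightarrow>
              approx_zero_respecting_LE n A c \<epsilon> (fw_lottery A x) (fw_prices c (\<beta> T)))))"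

end

theory Submission
  imports Defs
begin

text \<open>
  The potential \<open>\<Sum>i. ln (\<beta> i)\<close> starts at \<open>\<Sum>i. ln (1 / \<delta>)\<close> and, because the axis-cutting
  alternatives force \<open>\<beta> i \<ge> 1 / \<alpha> i\<close>, never falls below \<open>\<Sum>i. ln (1 / \<alpha> i)\<close>. The previous iterate is
  feasible for the current linear program, so the ratios \<open>r i\<close> of consecutive iterates sum to at
  most \<open>n\<close>; since \<open>ln r - (r - 1)\<close> is at most \<open>- (r - 1)\<^sup>2 / 4\<close> for \<open>r\<close> near 1, an iteration that does
  not meet the stopping criterion lowers the potential by at least a constant times \<open>\<epsilon>\<^sup>2\<close>.
  On stopping, complementary slackness turns the dual solution into a lottery at which agent \<open>i\<close>
  spends \<open>r i / (\<Sum>j. r j)\<close>, which is \<open>1 / n\<close> up to \<open>\<epsilon>\<close>.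
\<close>

section \<open>Linear programming duality\<close>

text \<open>Supplies the value of an eliminated variable, between its lower and its upper bounds.
  Either set may be empty; if both are, 0 is an arbitrary default.\<close>

lemma finite_separating_point:
  fixes L U :: "'b::{linorder,zero} set"
  assumes "finite L" "finite U" "\<And>l u. l \<in> L \<Longrightarrow> u \<in> U \<Longrightarrow> l \<le> u"
  obtains v where "\<And>l. l \<in> L \<Longrightarrow> l \<le> v" "\<And>u. u \<in> U \<Longrightarrow> v \<le> u"
proof (cases "L = {}")
  case True
  then show ?thesis
    using that[of 0] that[of "Min U"] assms(2) by (cases "U = {}") auto
next
  case False
  then show ?thesis
    using that[of "Max L"] assms by auto
qed

text \<open>
  A pair \<open>(f, b)\<close> stands for the inequality \<open>\<Sum>i\<in>I. f i * z i \<le> b\<close>. Letting the certificate range over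
  an arbitrary convex cone \<open>K\<close> of inequalities, rather than over multipliers of the rows of \<open>F\<close>,
  is what makes the induction on the variables go through.
\<close>

lemma fourier_motzkin:
  fixes K :: "(('v \<Rightarrow> real) \<times> real) set"
  assumes "finite I" "finite F" "F \<subseteq> K"
    and "\<And>f b g d. (f, b) \<in> K \<Longrightarrow> (g, d) \<in> K \<Longrightarrow> (\<lambda>i. f i + g i, b + d) \<in> K"
    and "\<And>f b r. (f, b) \<in> K \<Longrightarrow> 0 < r \<Longrightarrow> (\<lambda>i. r * f i, r * b) \<in> K"
  shows "(\<exists>z. \<forall>(f, b)\<in>F. (\<Sum>i\<in>I. f i * z i) \<le> b) \<or>
         (\<exists>f b. (f, b) \<in> K \<and> (\<forall>i\<in>I. f i = 0) \<and> b < 0)"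
  using assms
proof (induction I arbitrary: F K rule: finite_induct)
  case empty
  \<comment> \<open>Without variables a row \<open>(f, b)\<close> reads \<open>0 \<le> b\<close>,
    and a violated row is itself the certificate.\<close>
  then show ?case by (auto simp: not_le) force
next
  case (insert j I)
  note add = insert.prems(3) and scale = insert.prems(4)
  \<comment> \<open>The weights \<open>- g j\<close> and \<open>f j\<close>, positive for rows from
    \<open>M\<close> and \<open>P\<close>, cancel the coefficient of \<open>j\<close>.\<close>
  define comb :: "(('v \<Rightarrow> real) \<times> real) \<times> (('v \<Rightarrow> real) \<times> real) \<Rightarrow> ('v \<Rightarrow> real) \<times> real"
    where "comb = (\<lambda>((f, b), (g, d)). (\<lambda>i. (- g j) * f i + f j * g i, (- g j) * b + f j * d))"
  define P where "P = {(f, b) \<in> F. 0 < f j}"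
  define M where "M = {(f, b) \<in> F. f j < 0}"
  define Z where "Z = {(f, b) \<in> F. f j = 0}"
  define F' where "F' = Z \<union> comb ` (P \<times> M)"
  \<comment> \<open>\<open>K'\<close> is again closed under sums and positive scaling, and a
    certificate in it also vanishes at \<open>j\<close>, so it serves for
    \<open>insert j I\<close>.\<close>
  define K' where "K' = {(f, b) \<in> K. f j = 0}"
  have fin: "finite P" "finite M" "finite Z"
    unfolding P_def M_def Z_def
    by (rule finite_subset[OF _ \<open>finite F\<close>], blast)+
  have combK: "comb ((f, b), (g, d)) \<in> K'" if "(f, b) \<in> P" "(g, d) \<in> M" for f b g d
  proof -
    have "(f, b) \<in> K" "(g, d) \<in> K" "0 < f j" "0 < - g j"
      using that insert.prems(2) by (auto simp: P_def M_def)
    then have "(\<lambda>i. (- g j) * f i + f j * g i, (- g j) * b + f j * d) \<in> K"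
      by (intro add scale)
    then show ?thesis by (auto simp: K'_def comb_def)
  qed
  have "(\<exists>z. \<forall>(f, b)\<in>F'. (\<Sum>i\<in>I. f i * z i) \<le> b) \<or>
        (\<exists>f b. (f, b) \<in> K' \<and> (\<forall>i\<in>I. f i = 0) \<and> b < 0)"
  proof (rule insert.IH)
    show "finite F'" using fin by (auto simp: F'_def)
    show "F' \<subseteq> K'"
    proof -
      have "Z \<subseteq> K'" using insert.prems(2) by (auto simp: Z_def K'_def)
      moreover have "comb ` (P \<times> M) \<subseteq> K'" using combK by (force simp del: split_paired_All)
      ultimately show ?thesis by (simp add: F'_def)
    qed
  qed (auto simp: K'_def intro!: add scale)
  then consider (sol) z where "\<And>f b. (f, b) \<in> F' \<Longrightarrow> (\<Sum>i\<in>I. f i * z i) \<le> b"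
    | (cert) f b where "(f, b) \<in> K'" "\<forall>i\<in>I. f i = 0" "b < 0"
    by blast
  then show ?case
  proof cases
    case cert
    then show ?thesis by (auto simp: K'_def)
  next
    case (sol z)
    \<comment> \<open>The bound that a row puts on variable \<open>j\<close> once the others are
      fixed to \<open>z\<close>: upper for rows in \<open>P\<close>, lower for rows in
      \<open>M\<close>.\<close>
    define \<rho> where "\<rho> = (\<lambda>(f, b). (b - (\<Sum>i\<in>I. f i * z i)) / f j)"
    have "\<rho> q \<le> \<rho> p" if "p \<in> P" "q \<in> M" for p q
    proof -
      obtain f b g d where pq: "p = (f, b)" "q = (g, d)" by (meson surj_pair)
      have sg: "0 < f j" "g j < 0" using that by (auto simp: pq P_def M_def)
      have "comb (p, q) \<in> F'" using that by (auto simp: F'_def)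
      then have "(\<Sum>i\<in>I. ((- g j) * f i + f j * g i) * z i) \<le> (- g j) * b + f j * d"
        by (intro sol) (auto simp: comb_def pq)
      also have "(\<Sum>i\<in>I. ((- g j) * f i + f j * g i) * z i)
          = (- g j) * (\<Sum>i\<in>I. f i * z i) + f j * (\<Sum>i\<in>I. g i * z i)"
        by (simp add: sum_distrib_left sum.distrib[symmetric] algebra_simps)
      finally show ?thesis using sg by (auto simp: \<rho>_def pq field_simps)
    qed
    then have "\<And>l u. l \<in> \<rho> ` M \<Longrightarrow> u \<in> \<rho> ` P \<Longrightarrow> l \<le> u" by blast
    then obtain v where "\<And>l. l \<in> \<rho> ` M \<Longrightarrow> l \<le> v" "\<And>u. u \<in> \<rho> ` P \<Longrightarrow> v \<le> u"
      using finite_separating_point[of "\<rho> ` M" "\<rho> ` P"] fin(1,2) by blast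
    then have v: "\<And>q. q \<in> M \<Longrightarrow> \<rho> q \<le> v" "\<And>p. p \<in> P \<Longrightarrow> v \<le> \<rho> p" by blast+
    have "(\<Sum>i\<in>insert j I. f i * (z(j := v)) i) \<le> b" if F: "(f, b) \<in> F" for f b
    proof -
      have split: "(\<Sum>i\<in>insert j I. f i * (z(j := v)) i) = f j * v + (\<Sum>i\<in>I. f i * z i)"
        using insert.hyps by (auto intro!: sum.cong)
      consider "f j = 0" | "0 < f j" | "f j < 0" by linarith
      then show ?thesis
      proof cases
        case 1
        then have "(f, b) \<in> F'" using F by (auto simp: F'_def Z_def)
        from sol[OF this] 1 show ?thesis unfolding split by simp
      next
        case 2
        then have "v \<le> \<rho> (f, b)" using F by (intro v) (auto simp: P_def)
        with 2 show ?thesis unfolding split by (auto simp: \<rho>_def field_simps)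
      next
        case 3
        then have "\<rho> (f, b) \<le> v" using F by (intro v) (auto simp: M_def)
        with 3 show ?thesis unfolding split by (auto simp: \<rho>_def field_simps)
      qed
    qed
    then show ?thesis by blast
  qed
qed

text \<open>Elimination is applied to the rows of \<open>M\<close> together with the sign
  constraints on \<open>z\<close>; a contradictory inequality in the cone of their consequences
  yields \<open>y\<close>.\<close>

lemma gale_alternative:
  fixes M :: "'j \<Rightarrow> 'v \<Rightarrow> real" and b :: "'j \<Rightarrow> real"
  assumes "finite I" "finite J"
  shows "(\<exists>z. (\<forall>i\<in>I. 0 \<le> z i) \<and> (\<forall>j\<in>J. (\<Sum>i\<in>I. M j i * z i) \<le> b j)) \<or>
         (\<exists>y. (\<forall>j\<in>J. 0 \<le> y j) \<and> (\<forall>i\<in>I. 0 \<le> (\<Sum>j\<in>J. y j * M j i)) \<and> (\<Sum>j\<in>J. y j * b j) < 0)"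
proof -
  \<comment> \<open>Coefficients are bounded by the combination, not equal to it: the slack absorbs
    the multipliers of the sign constraints, so \<open>y\<close> records only those of the rows of
    \<open>M\<close>.\<close>
  define K where "K = {(f, d). \<exists>y. (\<forall>j\<in>J. 0 \<le> y j) \<and>
    (\<forall>i\<in>I. f i \<le> (\<Sum>j\<in>J. y j * M j i)) \<and> d = (\<Sum>j\<in>J. y j * b j)}"
  define F where "F = (\<lambda>j. (M j, b j)) ` J \<union> (\<lambda>i. (\<lambda>k. if k = i then - 1 else 0, 0)) ` I"
  have row: "(M j, b j) \<in> K" if "j \<in> J" for j
    using that assms
    by (auto simp: K_def if_distrib[of "\<lambda>t. t * _"] cong: if_cong
        intro!: exI[of _ "\<lambda>k. if k = j then 1 else 0"])
  have axis: "(\<lambda>k. if k = i then - 1 else 0, 0) \<in> K" if "i \<in> I" for i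
    by (auto simp: K_def intro!: exI[of _ "\<lambda>_. 0"])
  have "(\<exists>z. \<forall>(f, d)\<in>F. (\<Sum>i\<in>I. f i * z i) \<le> d) \<or>
        (\<exists>f d. (f, d) \<in> K \<and> (\<forall>i\<in>I. f i = 0) \<and> d < 0)"
  proof (rule fourier_motzkin)
    show "F \<subseteq> K" using row axis by (auto simp: F_def)
  next
    fix f d g e
    assume "(f, d) \<in> K" "(g, e) \<in> K"
    then obtain y y' where "\<forall>j\<in>J. 0 \<le> y j" "\<forall>i\<in>I. f i \<le> (\<Sum>j\<in>J. y j * M j i)"
        "d = (\<Sum>j\<in>J. y j * b j)" "\<forall>j\<in>J. 0 \<le> y' j" "\<forall>i\<in>I. g i \<le> (\<Sum>j\<in>J. y' j * M j i)"
        "e = (\<Sum>j\<in>J. y' j * b j)"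
      by (auto simp: K_def)
    then show "(\<lambda>i. f i + g i, d + e) \<in> K"
      by (auto simp: K_def distrib_right sum.distrib intro!: exI[of _ "\<lambda>j. y j + y' j"] add_mono)
  next
    fix f d and r :: real
    assume "(f, d) \<in> K" "0 < r"
    then obtain y where "\<forall>j\<in>J. 0 \<le> y j" "\<forall>i\<in>I. f i \<le> (\<Sum>j\<in>J. y j * M j i)"
        "d = (\<Sum>j\<in>J. y j * b j)"
      by (auto simp: K_def)
    with \<open>0 < r\<close> show "(\<lambda>i. r * f i, r * d) \<in> K"
      by (auto simp: K_def mult.assoc sum_distrib_left[symmetric]
          intro!: exI[of _ "\<lambda>j. r * y j"] mult_left_mono)
  qed (use assms in \<open>auto simp: F_def\<close>)
  then consider (sol) z where "\<And>f d. (f, d) \<in> F \<Longrightarrow> (\<Sum>i\<in>I. f i * z i) \<le> d"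
    | (cert) f d where "(f, d) \<in> K" "\<forall>i\<in>I. f i = 0" "d < 0"
    by blast
  then show ?thesis
  proof cases
    case (sol z)
    have "0 \<le> z i" if "i \<in> I" for i
    proof -
      have "(\<Sum>k\<in>I. (if k = i then - 1 else 0) * z k) \<le> 0"
        using that by (intro sol) (auto simp: F_def)
      then show ?thesis
        using that assms by (simp add: if_distrib[of "\<lambda>t. t * _"] cong: if_cong)
    qed
    moreover have "(\<Sum>i\<in>I. M j i * z i) \<le> b j" if "j \<in> J" for j
      using that by (intro sol) (auto simp: F_def)
    ultimately show ?thesis by blast
  next
    case cert
    then show ?thesis by (auto simp: K_def)
  qed
qed

section \<open>Duality for covering and packing programs\<close>

lemma sum_swap_weighted:
  fixes M :: "'i \<Rightarrow> 'a \<Rightarrow> 'r::comm_semiring_0"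
  shows "(\<Sum>a\<in>A. x a * (\<Sum>i\<in>I. M i a * u i)) = (\<Sum>i\<in>I. u i * (\<Sum>a\<in>A. M i a * x a))"
  unfolding sum_distrib_left by (subst sum.swap) (simp add: ac_simps)

text \<open>
  The alternative is applied to the combined system: covering constraints on \<open>u\<close> (indexed
  \<open>Some (Inr a)\<close>), packing constraints on \<open>x\<close> (indexed \<open>Some (Inl i)\<close>), and vanishing duality gap
  (indexed \<open>None\<close>).
\<close>

lemma covering_packing_strong_duality:
  fixes M :: "'i \<Rightarrow> 'a \<Rightarrow> real" and w :: "'i \<Rightarrow> real"
  assumes fin: "finite I" "finite A"
    and M: "\<And>i a. i \<in> I \<Longrightarrow> a \<in> A \<Longrightarrow> 0 \<le> M i a"
    and pos: "\<And>a. a \<in> A \<Longrightarrow> \<exists>i\<in>I. 0 < M i a"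
    and w: "\<And>i. i \<in> I \<Longrightarrow> 0 \<le> w i"
  obtains u x where "\<And>i. i \<in> I \<Longrightarrow> 0 \<le> u i" "\<And>a. a \<in> A \<Longrightarrow> 1 \<le> (\<Sum>i\<in>I. M i a * u i)"
    "\<And>a. a \<in> A \<Longrightarrow> 0 \<le> x a" "\<And>i. i \<in> I \<Longrightarrow> (\<Sum>a\<in>A. M i a * x a) \<le> w i"
    "(\<Sum>i\<in>I. w i * u i) \<le> (\<Sum>a\<in>A. x a)"
proof -
  define V :: "('i + 'a) set" where "V = I <+> A"
  define R :: "('i + 'a) option \<Rightarrow> ('i + 'a) \<Rightarrow> real" where
    "R = (\<lambda>k v. case k of
        None \<Rightarrow> (case v of Inl i \<Rightarrow> w i | Inr a \<Rightarrow> - 1)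
      | Some (Inl i) \<Rightarrow> (case v of Inl _ \<Rightarrow> 0 | Inr a \<Rightarrow> M i a)
      | Some (Inr a) \<Rightarrow> (case v of Inl i \<Rightarrow> - M i a | Inr _ \<Rightarrow> 0))"
  define b :: "('i + 'a) option \<Rightarrow> real" where
    "b = (\<lambda>k. case k of None \<Rightarrow> 0 | Some (Inl i) \<Rightarrow> w i | Some (Inr a) \<Rightarrow> - 1)"
  define J where "J = insert None (Some ` V)"
  have sumV: "(\<Sum>v\<in>V. h v) = (\<Sum>i\<in>I. h (Inl i)) + (\<Sum>a\<in>A. h (Inr a))" for h :: "_ \<Rightarrow> real"
    unfolding V_def using fin by (simp add: sum.Plus)
  have finV: "finite V" using fin by (simp add: V_def)
  have sumJ: "(\<Sum>k\<in>J. h k) = h None + (\<Sum>i\<in>I. h (Some (Inl i))) + (\<Sum>a\<in>A. h (Some (Inr a)))"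
    for h :: "_ \<Rightarrow> real"
    unfolding J_def using finV by (simp add: sum.reindex sumV)
  from gale_alternative[OF finV, of J R b] finV
  consider (sol) z where "\<forall>v\<in>V. 0 \<le> z v" "\<forall>k\<in>J. (\<Sum>v\<in>V. R k v * z v) \<le> b k"
    | (cert) y where "\<forall>k\<in>J. 0 \<le> y k" "\<forall>v\<in>V. 0 \<le> (\<Sum>k\<in>J. y k * R k v)" "(\<Sum>k\<in>J. y k * b k) < 0"
    unfolding J_def by blast
  then show ?thesis
  proof cases
    case (sol z)
    show ?thesis
    proof (rule that[of "\<lambda>i. z (Inl i)" "\<lambda>a. z (Inr a)"])
      show "0 \<le> z (Inl i)" if "i \<in> I" for i using sol(1) that by (auto simp: V_def)
      show "0 \<le> z (Inr a)" if "a \<in> A" for a using sol(1) that by (auto simp: V_def)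
      show "1 \<le> (\<Sum>i\<in>I. M i a * z (Inl i))" if "a \<in> A" for a
        using sol(2)[rule_format, of "Some (Inr a)"] that
        by (auto simp: J_def V_def sumV[unfolded V_def] R_def b_def sum_negf)
      show "(\<Sum>a\<in>A. M i a * z (Inr a)) \<le> w i" if "i \<in> I" for i
        using sol(2)[rule_format, of "Some (Inl i)"] that
        by (auto simp: J_def V_def sumV[unfolded V_def] R_def b_def)
      show "(\<Sum>i\<in>I. w i * z (Inl i)) \<le> (\<Sum>a\<in>A. z (Inr a))"
        using sol(2)[rule_format, of None]
        by (auto simp: J_def sumV R_def b_def sum_negf)
    qed
  next
    case (cert y)
    define l where "l = y None"
    define u where "u i = y (Some (Inl i))" for i
    define x where "x a = y (Some (Inr a))" for a
    have nn: "0 \<le> l" "\<And>i. i \<in> I \<Longrightarrow> 0 \<le> u i" "\<And>a. a \<in> A \<Longrightarrow> 0 \<le> x a"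
      using cert(1) by (auto simp: l_def u_def x_def J_def V_def)
    have xw: "(\<Sum>a\<in>A. M i a * x a) \<le> l * w i" if "i \<in> I" for i
      using cert(2)[rule_format, of "Inl i"] that
      by (auto simp: sumJ V_def R_def l_def x_def sum_negf mult.commute)
    have ul: "l \<le> (\<Sum>i\<in>I. M i a * u i)" if "a \<in> A" for a
      using cert(2)[rule_format, of "Inr a"] that
      by (auto simp: sumJ V_def R_def l_def u_def mult.commute)
    have gap: "(\<Sum>i\<in>I. u i * w i) < (\<Sum>a\<in>A. x a)"
      using cert(3) by (simp add: sumJ b_def u_def x_def sum_negf)
    have uw: "0 \<le> (\<Sum>i\<in>I. u i * w i)" using nn w by (auto intro!: sum_nonneg)
    \<comment> \<open>The weak duality chain, scaled by the multiplier \<open>l\<close> of the gap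
      constraint; its conclusion contradicts the strict inequality \<open>gap\<close> unless
      \<open>l = 0\<close>.\<close>
    have "l * (\<Sum>a\<in>A. x a) = (\<Sum>a\<in>A. x a * l)" by (simp add: sum_distrib_left mult.commute)
    also have "\<dots> \<le> (\<Sum>a\<in>A. x a * (\<Sum>i\<in>I. M i a * u i))"
      by (intro sum_mono mult_left_mono nn ul)
    also have "\<dots> = (\<Sum>i\<in>I. u i * (\<Sum>a\<in>A. M i a * x a))" by (rule sum_swap_weighted)
    also have "\<dots> \<le> (\<Sum>i\<in>I. u i * (l * w i))"
      by (rule sum_mono) (simp add: mult_left_mono nn xw)
    also have "\<dots> = l * (\<Sum>i\<in>I. u i * w i)" by (simp add: sum_distrib_left ac_simps)
    finally have "l = 0" using gap nn(1) by (simp add: mult_le_cancel_left)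
    \<comment> \<open>With \<open>l = 0\<close> the packing constraints have right-hand side 0, and
      each column of \<open>M\<close> has a positive entry. Once \<open>x\<close> vanishes,
      \<open>gap\<close> contradicts \<open>uw\<close>.\<close>
    have "x a = 0" if a: "a \<in> A" for a
    proof -
      obtain i where i: "i \<in> I" "0 < M i a" using pos[OF a] by blast
      have "M i a * x a \<le> (\<Sum>a\<in>A. M i a * x a)"
        using a fin i nn M by (intro member_le_sum) auto
      then have "M i a * x a \<le> 0" using xw[OF i(1)] \<open>l = 0\<close> by simp
      then show ?thesis using i nn(3)[OF a] by (simp add: mult_le_0_iff)
    qed
    then show ?thesis using gap uw by simp
  qed
qed

lemma covering_packing_weak_duality:
  fixes M :: "'i \<Rightarrow> 'a \<Rightarrow> real"
  assumes "\<And>i. i \<in> I \<Longrightarrow> 0 \<le> u i" "\<And>a. a \<in> A \<Longrightarrow> 1 \<le> (\<Sum>i\<in>I. M i a * u i)"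
    and "\<And>a. a \<in> A \<Longrightarrow> 0 \<le> x a" "\<And>i. i \<in> I \<Longrightarrow> (\<Sum>a\<in>A. M i a * x a) \<le> w i"
  shows "(\<Sum>a\<in>A. x a) \<le> (\<Sum>i\<in>I. w i * u i)"
proof -
  have "(\<Sum>a\<in>A. x a) \<le> (\<Sum>a\<in>A. x a * (\<Sum>i\<in>I. M i a * u i))"
    using assms by (intro sum_mono) (simp add: mult_le_cancel_left1 leD)
  also have "\<dots> = (\<Sum>i\<in>I. u i * (\<Sum>a\<in>A. M i a * x a))" by (rule sum_swap_weighted)
  also have "\<dots> \<le> (\<Sum>i\<in>I. w i * u i)"
    using assms by (intro sum_mono) (simp add: mult_left_mono mult.commute[of "w _"])
  finally show ?thesis .
qed

lemma sum_eq_termwise: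
  fixes f g :: "'a \<Rightarrow> real"
  assumes "finite A" "\<And>a. a \<in> A \<Longrightarrow> f a \<le> g a" "sum g A \<le> sum f A" "a \<in> A"
  shows "f a = g a"
proof (rule ccontr)
  assume "f a \<noteq> g a"
  then have "f a < g a" using assms by force
  then have "sum f A < sum g A" using assms by (intro sum_strict_mono_ex1) auto
  then show False using assms by simp
qed

text \<open>The weak duality chain collapses when the gap closes, so both of its inequalities are
  equalities term by term, and a positive \<open>u i\<close> or \<open>x a\<close> cancels.\<close>

lemma complementary_slackness:
  fixes M :: "'i \<Rightarrow> 'a \<Rightarrow> real"
  assumes fin: "finite I" "finite A"
    and u: "\<And>i. i \<in> I \<Longrightarrow> 0 \<le> u i" "\<And>a. a \<in> A \<Longrightarrow> 1 \<le> (\<Sum>i\<in>I. M i a * u i)"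
    and x: "\<And>a. a \<in> A \<Longrightarrow> 0 \<le> x a" "\<And>i. i \<in> I \<Longrightarrow> (\<Sum>a\<in>A. M i a * x a) \<le> w i"
    and gap: "(\<Sum>i\<in>I. w i * u i) \<le> (\<Sum>a\<in>A. x a)"
  shows "\<And>i. i \<in> I \<Longrightarrow> 0 < u i \<Longrightarrow> (\<Sum>a\<in>A. M i a * x a) = w i"
    and "\<And>a. a \<in> A \<Longrightarrow> 0 < x a \<Longrightarrow> (\<Sum>i\<in>I. M i a * u i) = 1"
proof -
  let ?mid = "\<Sum>a\<in>A. x a * (\<Sum>i\<in>I. M i a * u i)"
  have le1: "x a \<le> x a * (\<Sum>i\<in>I. M i a * u i)" if "a \<in> A" for a
    using u x that by (simp add: mult_le_cancel_left1 leD)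
  have le2: "u i * (\<Sum>a\<in>A. M i a * x a) \<le> w i * u i" if "i \<in> I" for i
    using u x that by (simp add: mult_left_mono mult.commute[of "w _"])
  have mid: "?mid = (\<Sum>i\<in>I. u i * (\<Sum>a\<in>A. M i a * x a))" by (rule sum_swap_weighted)
  have "(\<Sum>a\<in>A. x a) \<le> ?mid" using le1 by (rule sum_mono)
  moreover have "?mid \<le> (\<Sum>i\<in>I. w i * u i)" unfolding mid using le2 by (rule sum_mono)
  ultimately have ends: "?mid \<le> (\<Sum>a\<in>A. x a)"
      "(\<Sum>i\<in>I. w i * u i) \<le> (\<Sum>i\<in>I. u i * (\<Sum>a\<in>A. M i a * x a))"
    using gap mid by linarith+
  show "(\<Sum>a\<in>A. M i a * x a) = w i" if "i \<in> I" "0 < u i" for i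
    using sum_eq_termwise[OF fin(1) le2 ends(2) that(1)] that by simp
  show "(\<Sum>i\<in>I. M i a * u i) = 1" if "a \<in> A" "0 < x a" for a
    using sum_eq_termwise[OF fin(2) le1 ends(1) that(1)] that by simp
qed

section \<open>Potential decrease\<close>

text \<open>The difference of the two sides vanishes at 1, and its derivative
  \<open>(t - 1) * (2 - t) / (2 * t)\<close> is nonpositive up to 1 and nonnegative from 1 to
  2.\<close>

lemma ln_le_quadratic:
  fixes r :: real
  assumes "0 < r" "r \<le> 2"
  shows "ln r \<le> (r - 1) - (r - 1)\<^sup>2 / 4"
proof -
  define h where "h t = (t - 1) - (t - 1)\<^sup>2 / 4 - ln t" for t :: real
  have der: "(h has_real_derivative ((t - 1) * (2 - t) / (2 * t))) (at t)" if "0 < t" for t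
    unfolding h_def using that
    by (auto intro!: derivative_eq_intros simp: field_simps power2_eq_square)
  have "h 1 \<le> h r"
  proof (cases "1 \<le> r")
    case True
    then show ?thesis
    proof (rule DERIV_nonneg_imp_nondecreasing)
      fix t assume "1 \<le> t" "t \<le> r"
      then show "\<exists>y. (h has_real_derivative y) (at t) \<and> 0 \<le> y"
        using der[of t] assms by (intro exI conjI) auto
    qed
  next
    case False
    then have "r \<le> 1" by simp
    then show ?thesis
    proof (rule DERIV_nonpos_imp_nonincreasing)
      fix t assume "r \<le> t" "t \<le> 1"
      then show "\<exists>y. (h has_real_derivative y) (at t) \<and> y \<le> 0"
        using der[of t] assms
        by (intro exI conjI) (auto intro!: divide_nonpos_pos mult_nonpos_nonneg)
    qed
  qed
  then show ?thesis by (simp add: h_def)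
qed

lemma ln_le_minus_quarter:
  fixes r :: real
  assumes "2 \<le> r"
  shows "ln r \<le> (r - 1) - 1 / 4"
proof -
  have "ln r = ln 2 + ln (r / 2)" using assms by (simp add: ln_div)
  \<comment> \<open>\<open>3 / 4\<close> is the quadratic bound on \<open>ln 2\<close>.\<close>
  also have "\<dots> \<le> 3 / 4 + (r / 2 - 1)"
    using ln_le_quadratic[of 2] ln_le_minus_one[of "r / 2"] assms by simp
  finally show ?thesis using assms by simp
qed

text \<open>The linear terms \<open>r i - 1\<close> sum to at most 0, so only the losses count. If
  no ratio exceeds 2, the quadratic terms add up to the claim; otherwise one large ratio alone loses
  1/4, which suffices as \<open>\<eta>\<^sup>2 \<le> 1\<close>.\<close>

lemma sum_ln_decrease:
  fixes r :: "'i \<Rightarrow> real"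
  assumes "finite I" and r: "\<And>i. i \<in> I \<Longrightarrow> 0 < r i"
    and sum: "(\<Sum>i\<in>I. r i) \<le> card I"
    and far: "\<eta>\<^sup>2 \<le> (\<Sum>i\<in>I. (r i - 1)\<^sup>2)" and "\<eta>\<^sup>2 \<le> 1"
  shows "(\<Sum>i\<in>I. ln (r i)) \<le> - (\<eta>\<^sup>2 / 4)"
proof -
  have le: "ln (r i) \<le> r i - 1" if "i \<in> I" for i using r[OF that] by (rule ln_le_minus_one)
  have base: "(\<Sum>i\<in>I. r i - 1) \<le> 0" using sum by (simp add: sum_subtractf)
  show ?thesis
  proof (cases "\<forall>i\<in>I. r i \<le> 2")
    case True
    then have "(\<Sum>i\<in>I. ln (r i)) \<le> (\<Sum>i\<in>I. (r i - 1) - (r i - 1)\<^sup>2 / 4)"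
      using r by (intro sum_mono ln_le_quadratic) auto
    also have "\<dots> = (\<Sum>i\<in>I. r i - 1) - (\<Sum>i\<in>I. (r i - 1)\<^sup>2) / 4"
      by (simp add: sum_subtractf sum_divide_distrib)
    finally show ?thesis using base far by linarith
  next
    case False
    then obtain k where k: "k \<in> I" "2 \<le> r k" by force
    have "(\<Sum>i\<in>I. ln (r i)) = ln (r k) + (\<Sum>i\<in>I - {k}. ln (r i))"
      using k assms(1) by (simp add: sum.remove)
    also have "\<dots> \<le> (r k - 1) - 1 / 4 + (\<Sum>i\<in>I - {k}. r i - 1)"
      using k le by (intro add_mono ln_le_minus_quarter sum_mono) auto
    also have "\<dots> = (\<Sum>i\<in>I. r i - 1) - 1 / 4"
      using k assms(1) by (simp add: sum.remove)
    finally show ?thesis using base assms(5) by linarith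
  qed
qed

section \<open>The algorithm on axes-cutting instances\<close>

text \<open>\<open>alt\<close> is an arbitrary selection of axis-cutting alternatives, so the bound
  is proved for every choice of the values \<alpha>.\<close>

locale axes_cutting_instance =
  fixes n :: nat and A :: "'a set" and c :: "nat \<Rightarrow> 'a \<Rightarrow> real" and alt :: "nat \<Rightarrow> 'a"
  assumes bads: "public_bads n A c"
    and cuts: "\<And>i. i \<in> {1..n} \<Longrightarrow> cuts_axis n A c i (alt i)"
begin

abbreviation \<delta> :: real where "\<delta> \<equiv> min_pos_cost n A c"

abbreviation \<alpha> :: "nat \<Rightarrow> real" where "\<alpha> i \<equiv> c i (alt i)"

lemma n_pos: "1 \<le> n" and finite_A: "finite A"
  and cost_nonneg: "i \<in> {1..n} \<Longrightarrow> a \<in> A \<Longrightarrow> 0 \<le> c i a"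
  using bads by (auto simp: public_bads_def)

lemma alt_in: "i \<in> {1..n} \<Longrightarrow> alt i \<in> A" and alpha_pos: "i \<in> {1..n} \<Longrightarrow> 0 < \<alpha> i"
  using cuts by (auto simp: cuts_axis_def)

text \<open>Otherwise the point mass at \<open>a\<close> would be a lottery with zero cost
  vector.\<close>

lemma exists_pos_cost:
  assumes a: "a \<in> A"
  shows "\<exists>i\<in>{1..n}. 0 < c i a"
proof (rule ccontr)
  assume "\<not> ?thesis"
  then have zero: "c i a = 0" if "i \<in> {1..n}" for i
    using cost_nonneg[OF that a] that by force
  let ?x = "\<lambda>k. if k = a then 1 else 0 :: real"
  have "?x \<in> lotteries A" using a finite_A by (auto simp: lotteries_def nonneg_vectors_def)
  moreover have "\<forall>i\<in>{1..n}. pair A (c i) ?x = 0"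
    using zero a finite_A by (auto simp: pair_def if_distrib[of "\<lambda>t. _ * t"] cong: if_cong)
  ultimately show False using bads by (auto simp: public_bads_def)
qed

lemma finite_pos_costs: "finite {c i a | i a. i \<in> {1..n} \<and> a \<in> A \<and> 0 < c i a}"
  by (rule finite_subset[of _ "(\<lambda>(i, a). c i a) ` ({1..n} \<times> A)"]) (auto simp: finite_A)

lemma delta_le: "i \<in> {1..n} \<Longrightarrow> a \<in> A \<Longrightarrow> 0 < c i a \<Longrightarrow> \<delta> \<le> c i a"
  unfolding min_pos_cost_def by (rule Min_le[OF finite_pos_costs]) auto

lemma delta_pos: "0 < \<delta>"
proof -
  have "1 \<in> {1..n}" using n_pos by simp
  then have "\<delta> \<in> {c i a | i a. i \<in> {1..n} \<and> a \<in> A \<and> 0 < c i a}"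
    unfolding min_pos_cost_def using alt_in alpha_pos
    by (intro Min_in[OF finite_pos_costs]) blast
  then show ?thesis by auto
qed

lemma initial_feasible:
  assumes "\<forall>i\<in>{1..n}. b i = 1 / \<delta>"
  shows "b \<in> feasible n A c"
proof -
  have "1 \<le> (\<Sum>i=1..n. c i a * b i)" if a: "a \<in> A" for a
  proof -
    obtain k where k: "k \<in> {1..n}" "0 < c k a" using exists_pos_cost[OF a] by blast
    have "1 \<le> c k a * b k" using assms k delta_le[OF k(1) a k(2)] delta_pos by simp
    also have "\<dots> \<le> (\<Sum>i=1..n. c i a * b i)"
      using k(1) assms delta_pos cost_nonneg a by (intro member_le_sum) auto
    finally show ?thesis .
  qed
  then show ?thesis using assms delta_pos by (auto simp: feasible_def)
qed

text \<open>In the covering constraint of \<open>alt i\<close> only agent \<open>i\<close>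
  contributes. This bounds the potential from below and keeps iterates positive.\<close>

lemma feasible_lower_bound:
  assumes b: "b \<in> feasible n A c" and i: "i \<in> {1..n}"
  shows "1 / \<alpha> i \<le> b i"
proof -
  have "1 \<le> (\<Sum>k=1..n. c k (alt i) * b k)" using b alt_in[OF i] by (auto simp: feasible_def)
  also have "\<dots> = (\<Sum>k=1..n. if k = i then \<alpha> i * b i else 0)"
    using cuts[OF i] by (intro sum.cong) (auto simp: cuts_axis_def)
  also have "\<dots> = \<alpha> i * b i" using i by simp
  finally show ?thesis using alpha_pos[OF i] by (simp add: field_simps)
qed

lemma feasible_pos: "b \<in> feasible n A c \<Longrightarrow> i \<in> {1..n} \<Longrightarrow> 0 < b i"
  using feasible_lower_bound[of b i] alpha_pos[of i] by (smt (verit) divide_pos_pos)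

section \<open>Solvability and duality of the linear programs of one iteration\<close>

lemma optimal_pair:
  assumes b: "b \<in> feasible n A c"
  obtains u x where "primal_optimal n A c b u" "dual_optimal n A c b x"
    "(\<Sum>i=1..n. 1 / real n * (u i / b i)) \<le> (\<Sum>a\<in>A. x a)"
proof -
  \<comment> \<open>With these right-hand sides the two programs form a covering and packing pair;
    weak duality against an arbitrary competitor turns the closed gap into optimality of both
    solutions.\<close>
  define w where "w i = 1 / (real n * b i)" for i
  have w: "0 \<le> w i" if "i \<in> {1..n}" for i using feasible_pos[OF b that] by (simp add: w_def)
  have obj: "(\<Sum>i=1..n. 1 / real n * (v i / b i)) = (\<Sum>i=1..n. w i * v i)" for v
    by (simp add: w_def)
  obtain u x where ux: "\<And>i. i \<in> {1..n} \<Longrightarrow> 0 \<le> u i" "\<And>a. a \<in> A \<Longrightarrow> 1 \<le> (\<Sum>i=1..n. c i a * u i)"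
    "\<And>a. a \<in> A \<Longrightarrow> 0 \<le> x a" "\<And>i. i \<in> {1..n} \<Longrightarrow> (\<Sum>a\<in>A. c i a * x a) \<le> w i"
    and gap: "(\<Sum>i=1..n. w i * u i) \<le> (\<Sum>a\<in>A. x a)"
    using covering_packing_strong_duality[of "{1..n}" A c w] cost_nonneg exists_pos_cost w finite_A
    by blast
  have "primal_optimal n A c b u"
    unfolding primal_optimal_def is_arg_min_linorder obj
  proof (intro conjI allI impI)
    show "u \<in> feasible n A c" using ux by (simp add: feasible_def)
    fix v assume "v \<in> feasible n A c"
    then have "(\<Sum>a\<in>A. x a) \<le> (\<Sum>i=1..n. w i * v i)"
      using ux by (intro covering_packing_weak_duality) (auto simp: feasible_def)
    then show "(\<Sum>i=1..n. w i * u i) \<le> (\<Sum>i=1..n. w i * v i)" using gap by simp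
  qed
  moreover have "dual_optimal n A c b x"
    unfolding dual_optimal_def is_arg_max_linorder
  proof (intro conjI allI impI)
    show "x \<in> nonneg_vectors A" "\<forall>i\<in>{1..n}. pair A (c i) x \<le> 1 / (real n * b i)"
      using ux by (auto simp: nonneg_vectors_def pair_def w_def)
    fix y
    assume "y \<in> nonneg_vectors A \<and> (\<forall>i\<in>{1..n}. pair A (c i) y \<le> 1 / (real n * b i))"
    then have "(\<Sum>a\<in>A. y a) \<le> (\<Sum>i=1..n. w i * u i)"
      using ux by (intro covering_packing_weak_duality) (auto simp: nonneg_vectors_def pair_def w_def)
    then show "(\<Sum>a\<in>A. y a) \<le> (\<Sum>a\<in>A. x a)" using gap by simp
  qed
  ultimately show ?thesis using that gap obj by simp
qed

text \<open>Carries the closed gap from one optimal pair to every optimal pair, since the algorithm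
  may pick any.\<close>

lemma optimal_values_eq:
  assumes "b \<in> feasible n A c" "primal_optimal n A c b u" "dual_optimal n A c b x"
  shows "(\<Sum>i=1..n. 1 / real n * (u i / b i)) \<le> (\<Sum>a\<in>A. x a)"
proof -
  obtain u' x' where opt: "primal_optimal n A c b u'" "dual_optimal n A c b x'"
    "(\<Sum>i=1..n. 1 / real n * (u' i / b i)) \<le> (\<Sum>a\<in>A. x' a)"
    using optimal_pair[OF assms(1)] by blast
  have "(\<Sum>i=1..n. 1 / real n * (u i / b i)) \<le> (\<Sum>i=1..n. 1 / real n * (u' i / b i))"
    using assms(2) opt(1) by (simp add: primal_optimal_def is_arg_min_linorder)
  also note opt(3)
  also have "(\<Sum>a\<in>A. x' a) \<le> (\<Sum>a\<in>A. x a)"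
    using assms(3) opt(2) by (simp add: dual_optimal_def is_arg_max_linorder)
  finally show ?thesis .
qed

text \<open>The previous iterate \<open>b\<close> is itself a competitor, with objective value
  1.\<close>

lemma ratio_sum_le:
  assumes b: "b \<in> feasible n A c" and u: "primal_optimal n A c b u"
  shows "(\<Sum>i=1..n. u i / b i) \<le> n"
proof -
  have "(\<Sum>i=1..n. 1 / real n * (u i / b i)) \<le> (\<Sum>i=1..n. 1 / real n * (b i / b i))"
    using b u unfolding primal_optimal_def is_arg_min_linorder by blast
  also have "\<dots> = (\<Sum>i=1..n. 1 / real n)"
    using feasible_pos[OF b] by (intro sum.cong refl) force
  also have "\<dots> = 1" using n_pos by simp
  finally have "1 / real n * (\<Sum>i=1..n. u i / b i) \<le> 1" by (simp only: sum_distrib_left)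
  then show ?thesis using n_pos by (simp add: pos_divide_le_eq)
qed

text \<open>Since \<open>u\<close> is positive, every dual constraint is tight, so agent
  \<open>i\<close> spends \<open>r i / (n * S)\<close>, where \<open>S\<close> is the average of the
  ratios. Both \<open>r i\<close> and \<open>S\<close> lie within \<open>\<epsilon> / 4\<close> of
  1.\<close>

lemma output_correct:
  assumes b: "b \<in> feasible n A c" and u: "primal_optimal n A c b u"
    and x: "dual_optimal n A c b x" and stop: "fw_stop n (\<epsilon> / 4) b u"
    and eps: "0 < \<epsilon>" "\<epsilon> \<le> 1"
  shows "approx_zero_respecting_LE n A c \<epsilon> (fw_lottery A x) (fw_prices c u)"
proof -
  define S where "S = (\<Sum>a\<in>A. x a)"
  define r where "r i = u i / b i" for i
  have uf: "u \<in> feasible n A c" using u by (simp add: primal_optimal_def is_arg_min_linorder)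
  have xf: "\<And>a. a \<in> A \<Longrightarrow> 0 \<le> x a"
      "\<And>i. i \<in> {1..n} \<Longrightarrow> (\<Sum>a\<in>A. c i a * x a) \<le> 1 / (real n * b i)"
    using x by (auto simp: dual_optimal_def is_arg_max_linorder nonneg_vectors_def pair_def)
  have gap: "(\<Sum>i=1..n. 1 / (real n * b i) * u i) \<le> (\<Sum>a\<in>A. x a)"
    using optimal_values_eq[OF b u x] by simp
  have uf': "\<And>i. i \<in> {1..n} \<Longrightarrow> 0 \<le> u i" "\<And>a. a \<in> A \<Longrightarrow> 1 \<le> (\<Sum>i=1..n. c i a * u i)"
    using uf by (auto simp: feasible_def)
  have upos: "0 < u i" if "i \<in> {1..n}" for i using feasible_pos[OF uf that] .
  have bpos: "0 < b i" if "i \<in> {1..n}" for i using feasible_pos[OF b that] .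
  have cx: "(\<Sum>a\<in>A. c i a * x a) = 1 / (real n * b i)" if "i \<in> {1..n}" for i
    using complementary_slackness(1)[OF finite_atLeastAtMost finite_A uf' xf gap that upos[OF that]]
    by simp
  have "S \<le> (\<Sum>i=1..n. 1 / (real n * b i) * u i)"
    unfolding S_def using uf' xf by (rule covering_packing_weak_duality)
  then have S: "S = (\<Sum>i=1..n. r i) / n"
    using gap by (simp add: S_def r_def sum_divide_distrib field_simps)
  have near: "\<bar>r i - 1\<bar> \<le> \<epsilon> / 4" if i: "i \<in> {1..n}" for i
  proof -
    have "(r i - 1)\<^sup>2 \<le> (\<Sum>i=1..n. (r i - 1)\<^sup>2)" using i by (intro member_le_sum) auto
    also have "\<dots> \<le> (\<epsilon> / 4)\<^sup>2" using stop by (simp add: fw_stop_def r_def)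
    finally show ?thesis using eps abs_le_square_iff[of "r i - 1" "\<epsilon> / 4"] by simp
  qed
  have S_near: "\<bar>S - 1\<bar> \<le> \<epsilon> / 4"
  proof -
    have "\<bar>\<Sum>i=1..n. r i - 1\<bar> \<le> (\<Sum>i=1..n. \<epsilon> / 4)"
      by (rule order_trans[OF sum_abs sum_mono]) (use near in auto)
    then have "\<bar>(\<Sum>i=1..n. r i) - n\<bar> \<le> n * (\<epsilon> / 4)" by (simp add: sum_subtractf)
    moreover have "(\<Sum>i=1..n. r i) - n = n * (S - 1)" using n_pos by (simp add: S algebra_simps)
    ultimately show ?thesis using n_pos by (simp add: abs_mult)
  qed
  \<comment> \<open>From \<open>\<epsilon> \<le> 1\<close>. It makes the normalization by
    \<open>S\<close> legitimate and, through \<open>1 / 2 \<le> S\<close>, absorbs the error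
    \<open>\<epsilon> / 2\<close> into \<open>\<epsilon> * S\<close>.\<close>
  then have S34: "3 / 4 \<le> S" using eps by linarith
  have spend: "pair A (fw_prices c u i) (fw_lottery A x) = r i / (n * S)" if i: "i \<in> {1..n}" for i
  proof -
    have "pair A (fw_prices c u i) (fw_lottery A x) = u i * (\<Sum>a\<in>A. c i a * x a) / S"
      by (simp add: pair_def fw_prices_def fw_lottery_def S_def sum_divide_distrib
          sum_distrib_left ac_simps)
    then show ?thesis by (simp add: cx[OF i] r_def)
  qed
  have dev: "\<bar>r i / (n * S) - 1 / n\<bar> \<le> \<epsilon>" if i: "i \<in> {1..n}" for i
  proof -
    have "\<bar>r i - S\<bar> \<le> \<epsilon> / 2" using near[OF i] S_near by linarith
    also have "\<dots> \<le> \<epsilon> * S" using S34 eps mult_left_mono[of "1 / 2" S \<epsilon>] by simp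
    also have "\<dots> \<le> \<epsilon> * (n * S)" using n_pos S34 eps by simp
    finally have "\<bar>r i - S\<bar> / (n * S) \<le> \<epsilon>" using n_pos S34 by (simp add: pos_divide_le_eq)
    moreover have "r i / (n * S) - 1 / n = (r i - S) / (n * S)"
      using n_pos S34 by (simp add: field_simps)
    ultimately show ?thesis using n_pos S34 by (simp add: abs_divide)
  qed
  show ?thesis
    unfolding approx_zero_respecting_LE_def
  proof (intro conjI ballI impI)
    show "fw_lottery A x \<in> lotteries A"
      using xf(1) S34 unfolding S_def
      by (auto simp: lotteries_def nonneg_vectors_def fw_lottery_def sum_divide_distrib[symmetric])
    show "fw_prices c u i \<in> nonneg_vectors A" if "i \<in> {1..n}" for i
      using cost_nonneg uf' that by (auto simp: nonneg_vectors_def fw_prices_def)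
    show "fw_prices c u i a = 0" if "c i a = 0" for i a using that by (simp add: fw_prices_def)
    show "1 / real n - \<epsilon> \<le> pair A (fw_prices c u i) (fw_lottery A x)"
      "pair A (fw_prices c u i) (fw_lottery A x) \<le> 1 / real n + \<epsilon>" if "i \<in> {1..n}" for i
      using dev[OF that] spend[OF that] by (auto simp: abs_le_iff)
    show "pair A (c i) (fw_lottery A x) \<le> pair A (c i) y"
      if "i \<in> {1..n}"
        "pair A (fw_prices c u i) (fw_lottery A x) \<le> pair A (fw_prices c u i) y" for i y
    proof -
      \<comment> \<open>Prices are a positive multiple of costs, so affordability comparisons and
        cost comparisons agree.\<close>
      have "pair A (fw_prices c u i) z = u i * pair A (c i) z" for z
        by (simp add: pair_def fw_prices_def sum_distrib_left ac_simps)
      then show ?thesis using that upos[OF that(1)] by simp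
    qed
    show "1 \<le> (\<Sum>i=1..n. fw_prices c u i a)" if "a \<in> A" for a
      using uf'(2)[OF that] by (simp add: fw_prices_def)
    show "(\<Sum>i=1..n. fw_prices c u i a) = 1" if "a \<in> A" "0 < fw_lottery A x a" for a
    proof -
      have "0 < x a"
        using that(2) S34 by (simp add: fw_lottery_def S_def[symmetric] zero_less_divide_iff)
      then show ?thesis
        using complementary_slackness(2)[OF finite_atLeastAtMost finite_A uf' xf gap that(1)]
        by (simp add: fw_prices_def)
    qed
  qed
qed

section \<open>Bound on the number of iterations\<close>

context
  fixes \<epsilon> :: real and \<beta> :: "nat \<Rightarrow> nat \<Rightarrow> real" and T :: nat
  assumes exec: "fw_execution n A c \<epsilon> \<beta> T" and eps: "0 < \<epsilon>" "\<epsilon> \<le> 1"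
begin

lemma initial_value: "i \<in> {1..n} \<Longrightarrow> \<beta> 0 i = 1 / \<delta>"
  using exec by (auto simp: fw_execution_def)

lemma step_optimal: "1 \<le> t \<Longrightarrow> t \<le> T \<Longrightarrow> primal_optimal n A c (\<beta> (t - 1)) (\<beta> t)"
  using exec by (auto simp: fw_execution_def)

lemma iterate_feasible: "t \<le> T \<Longrightarrow> \<beta> t \<in> feasible n A c"
  using initial_feasible[of "\<beta> 0"] initial_value step_optimal[of t]
  by (cases "t = 0") (auto simp: primal_optimal_def is_arg_min_linorder)

text \<open>The loss is \<open>(\<epsilon> / 4)\<^sup>2 / 4\<close>. The inequality
  \<open>Suc t < T\<close> is strict because the last step of an execution may meet the stopping
  criterion.\<close>

lemma step_decrease:
  assumes t: "Suc t < T"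
  shows "(\<Sum>i=1..n. ln (\<beta> (Suc t) i)) \<le> (\<Sum>i=1..n. ln (\<beta> t i)) - \<epsilon>\<^sup>2 / 64"
proof -
  let ?r = "\<lambda>i. \<beta> (Suc t) i / \<beta> t i"
  have f: "\<beta> t \<in> feasible n A c" "\<beta> (Suc t) \<in> feasible n A c"
    using t by (auto intro: iterate_feasible)
  note pos = feasible_pos[OF f(1)] feasible_pos[OF f(2)]
  have "\<not> fw_stopped n \<epsilon> \<beta> (Suc t)" using exec t by (auto simp: fw_execution_def)
  then have far: "(\<epsilon> / 4)\<^sup>2 \<le> (\<Sum>i=1..n. (?r i - 1)\<^sup>2)"
    by (simp add: fw_stopped_def fw_stop_def)
  have "(\<epsilon> / 4)\<^sup>2 \<le> 1" using eps by (intro power_le_one) auto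
  then have "(\<Sum>i=1..n. ln (?r i)) \<le> - ((\<epsilon> / 4)\<^sup>2 / 4)"
    using far pos ratio_sum_le[OF f(1)] step_optimal[of "Suc t"] t
    by (intro sum_ln_decrease) auto
  moreover have "(\<Sum>i=1..n. ln (?r i)) = (\<Sum>i=1..n. ln (\<beta> (Suc t) i)) - (\<Sum>i=1..n. ln (\<beta> t i))"
    unfolding sum_subtractf[symmetric]
  proof (intro sum.cong refl)
    fix i assume "i \<in> {1..n}"
    then show "ln (?r i) = ln (\<beta> (Suc t) i) - ln (\<beta> t i)"
      using pos(1)[of i] pos(2)[of i] by (simp add: ln_div)
  qed
  ultimately show ?thesis by (simp add: power_divide)
qed

lemma potential_bound:
  "t < T \<Longrightarrow> (\<Sum>i=1..n. ln (\<beta> t i)) \<le> (\<Sum>i=1..n. ln (1 / \<delta>)) - t * (\<epsilon>\<^sup>2 / 64)"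
proof (induction t)
  case 0
  then show ?case using initial_value by simp
next
  case (Suc t)
  have "Suc t * (\<epsilon>\<^sup>2 / 64) = t * (\<epsilon>\<^sup>2 / 64) + \<epsilon>\<^sup>2 / 64" by (simp add: distrib_right)
  moreover have "(\<Sum>i=1..n. ln (\<beta> t i)) \<le> (\<Sum>i=1..n. ln (1 / \<delta>)) - t * (\<epsilon>\<^sup>2 / 64)"
    using Suc by simp
  ultimately show ?case using step_decrease[OF Suc.prems] by linarith
qed

lemma iterations_bound: "T \<le> 1 + 64 * ((\<Sum>i=1..n. ln (\<alpha> i / \<delta>)) / \<epsilon>\<^sup>2)"
proof (cases T)
  case 0
  \<comment> \<open>Each \<alpha> is a positive cost, hence at least \<delta>.\<close>
  have "0 \<le> (\<Sum>i=1..n. ln (\<alpha> i / \<delta>))"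
    using delta_le alt_in alpha_pos delta_pos by (intro sum_nonneg ln_ge_zero) simp
  then show ?thesis using 0 by simp
next
  case (Suc t)
  \<comment> \<open>The potential is compared at \<open>T - 1\<close>; the final iteration, for
    which no decrease is claimed, accounts for the summand 1.\<close>
  have "(\<Sum>i=1..n. ln (1 / \<alpha> i)) \<le> (\<Sum>i=1..n. ln (\<beta> t i))"
    using feasible_lower_bound[OF iterate_feasible[of t]] feasible_pos[OF iterate_feasible[of t]]
      alpha_pos Suc
    by (intro sum_mono) (simp del: ln_divide_pos)
  also have "\<dots> \<le> (\<Sum>i=1..n. ln (1 / \<delta>)) - t * (\<epsilon>\<^sup>2 / 64)" using Suc by (intro potential_bound) simp
  finally have "t * (\<epsilon>\<^sup>2 / 64) \<le> (\<Sum>i=1..n. ln (1 / \<delta>) - ln (1 / \<alpha> i))"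
    unfolding sum_subtractf by linarith
  also have "\<dots> = (\<Sum>i=1..n. ln (\<alpha> i / \<delta>))"
    using alpha_pos delta_pos by (intro sum.cong refl) (force simp: ln_div)
  finally show ?thesis using Suc eps by (simp add: field_simps)
qed

end

lemma greedy_fw_finds_LE:
  assumes "0 < \<epsilon>" "\<epsilon> \<le> 1"
  shows "greedy_fw_finds_LE_within n A c \<epsilon> (1 + 64 * ((\<Sum>i=1..n. ln (\<alpha> i / \<delta>)) / \<epsilon>\<^sup>2))"
  unfolding greedy_fw_finds_LE_within_def
proof (intro allI impI conjI)
  fix \<beta> T
  assume exec: "fw_execution n A c \<epsilon> \<beta> T"
  note feas = iterate_feasible[OF exec assms]
  show "real T \<le> 1 + 64 * ((\<Sum>i=1..n. ln (\<alpha> i / \<delta>)) / \<epsilon>\<^sup>2)"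
    by (rule iterations_bound[OF exec assms])
  show "\<exists>b. primal_optimal n A c (\<beta> T) b"
    using optimal_pair[OF feas[of T]] by blast
  assume stopped: "fw_stopped n \<epsilon> \<beta> T"
  show "\<exists>x. dual_optimal n A c (\<beta> (T - 1)) x"
    using optimal_pair[OF feas[of "T - 1"]] by auto
  fix x
  assume "dual_optimal n A c (\<beta> (T - 1)) x"
  then show "approx_zero_respecting_LE n A c \<epsilon> (fw_lottery A x) (fw_prices c (\<beta> T))"
    using stopped feas[of "T - 1"] step_optimal[OF exec assms, of T] assms
    by (intro output_correct) (auto simp: fw_stopped_def)
qed

end

text \<open>The summand 1 matters when every \<alpha> equals \<delta>: the logarithms vanish, yet
  stopping takes at least one iteration. \<open>C\<close> is chosen before the instance, so it is
  uniform.\<close>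

theorem theorem6p4:
  "\<exists>C::real. 0 < C \<and>
     (\<forall>(n::nat) (A::'a set) (c::nat \<Rightarrow> 'a \<Rightarrow> real) (alt::nat \<Rightarrow> 'a) (\<epsilon>::real).
        public_bads n A c \<and> axes_cutting n A c \<and>
        (\<forall>i\<in>{1..n}. cuts_axis n A c i (alt i)) \<and>
        0 < \<epsilon> \<and> \<epsilon> \<le> 1 \<longrightarrow>
        greedy_fw_finds_LE_within n A c \<epsilon>
          (1 + C * ((\<Sum>i=1..n. ln (c i (alt i) / min_pos_cost n A c)) / \<epsilon>\<^sup>2)))"
proof (intro exI[of _ 64] conjI allI impI)
  fix n and A :: "'a set" and c alt and \<epsilon> :: real
  assume asm: "public_bads n A c \<and> axes_cutting n A c \<and>
    (\<forall>i\<in>{1..n}. cuts_axis n A c i (alt i)) \<and> 0 < \<epsilon> \<and> \<epsilon> \<le> 1"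
  then interpret axes_cutting_instance n A c alt by unfold_locales auto
  show "greedy_fw_finds_LE_within n A c \<epsilon>
      (1 + 64 * ((\<Sum>i=1..n. ln (c i (alt i) / min_pos_cost n A c)) / \<epsilon>\<^sup>2))"
    using asm by (intro greedy_fw_finds_LE) auto
qed simp

end
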